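(* Let $(X,T)$ be a system and $(Y,S)$ be a minimal system. Then $(X,T)\perp(Y,S)$ if and only if the set $$\{x\in X:(\overline{\mathcal{O}}(x,T),T)\perp(Y,S)\}$$ is residual in $X$.
   Context: A system is a pair $(X,T)$ with $X$ a compact metric space and $T:X\to X$ a homeomorphism. $\overline{\mathcal{O}}(x,T)$ is the closure of the orbit $\{T^nx:n\in\mathbb{Z}\}$. A system is minimal if it contains no proper nonempty closed invariant ($TA=A$) subset. A joining of $(X,T)$ and $(Y,S)$ is a closed set $J\subset X\times Y$ with $(T\times S)J=J$ projecting onto $X$ and onto $Y$; the systems are disjoint, written $(X,T)\perp(Y,S)$, if $X\times Y$ is their only joining. A set is residual if it contains a dense $G_\delta$ set. *)

theory Defs
  imports "HOL-Analysis.Analysis"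
begin

text \<open>
  The space of a system is a compact subset of a metric space type, so that orbit closures are
  again spaces of systems.  Only the values of the map on that subset matter.
  The empty space is not excluded.
\<close>

definition system :: "'a::metric_space set \<Rightarrow> ('a \<Rightarrow> 'a) \<Rightarrow> bool" where
  "system X T \<longleftrightarrow> compact X \<and> (\<exists>T'. homeomorphism X X T T')"

definition iterate :: "'a set \<Rightarrow> ('a \<Rightarrow> 'a) \<Rightarrow> int \<Rightarrow> 'a \<Rightarrow> 'a" where
  "iterate X T n = (if 0 \<le> n then T ^^ nat n else inv_into X T ^^ nat (- n))"

definition orbit :: "'a set \<Rightarrow> ('a \<Rightarrow> 'a) \<Rightarrow> 'a \<Rightarrow> 'a set" where
  "orbit X T x = range (\<lambda>n::int. iterate X T n x)"

text \<open>The closure is taken in the ambient type; as \<open>X\<close> is compact, it equals the closure in \<open>X\<close>.\<close>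

definition orbit_closure :: "'a::metric_space set \<Rightarrow> ('a \<Rightarrow> 'a) \<Rightarrow> 'a \<Rightarrow> 'a set" where
  "orbit_closure X T x = closure (orbit X T x)"

definition minimal_system :: "'a::metric_space set \<Rightarrow> ('a \<Rightarrow> 'a) \<Rightarrow> bool" where
  "minimal_system X T \<longleftrightarrow> system X T \<and>
     \<not> (\<exists>A. A \<subset> X \<and> A \<noteq> {} \<and> closedin (top_of_set X) A \<and> T ` A = A)"

definition joining ::
    "'a::metric_space set \<Rightarrow> ('a \<Rightarrow> 'a) \<Rightarrow> 'b::metric_space set \<Rightarrow> ('b \<Rightarrow> 'b) \<Rightarrow> ('a \<times> 'b) set \<Rightarrow> bool"
  where
  "joining X T Y S J \<longleftrightarrow>
     closedin (top_of_set (X \<times> Y)) J \<and> map_prod T S ` J = J \<and> fst ` J = X \<and> snd ` J = Y"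

text \<open>
  For nonempty systems, \<open>X \<times> Y\<close> is itself a joining (see \<open>joining_Times\<close> below).
\<close>

definition disjoint_systems ::
    "'a::metric_space set \<Rightarrow> ('a \<Rightarrow> 'a) \<Rightarrow> 'b::metric_space set \<Rightarrow> ('b \<Rightarrow> 'b) \<Rightarrow> bool" where
  "disjoint_systems X T Y S \<longleftrightarrow> (\<forall>J. joining X T Y S J \<longrightarrow> J = X \<times> Y)"

definition residual_in :: "'a topology \<Rightarrow> 'a set \<Rightarrow> bool" where
  "residual_in U A \<longleftrightarrow> A \<subseteq> topspace U \<and>
     (\<exists>G. gdelta_in U G \<and> U closure_of G = topspace U \<and> G \<subseteq> A)"

lemma system_image: "system X T \<Longrightarrow> T ` X = X"
  by (auto simp: system_def homeomorphism_def)

lemma joining_Times: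
  assumes "system X T" "system Y S" "X \<noteq> {}" "Y \<noteq> {}"
  shows "joining X T Y S (X \<times> Y)"
  using assms system_image[of X T] system_image[of Y S]
  by (simp add: joining_def map_prod_surj_on)

lemma disjoint_systems_iff_only_joining:
  assumes "system X T" "system Y S" "X \<noteq> {}" "Y \<noteq> {}"
  shows "disjoint_systems X T Y S \<longleftrightarrow> {J. joining X T Y S J} = {X \<times> Y}"
  using joining_Times[OF assms] by (auto simp: disjoint_systems_def)

lemma iterate_in:
  assumes "system X T" "x \<in> X"
  shows "iterate X T n x \<in> X"
proof -
  have "(T ^^ k) x \<in> X" for k
    using assms system_image[of X T] by (induction k) auto
  moreover have "(inv_into X T ^^ k) x \<in> X" for k
    using assms system_image[of X T] by (induction k) (auto intro: inv_into_into)
  ultimately show ?thesis by (simp add: iterate_def)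
qed

lemma iterate_Suc:
  assumes "system X T" "x \<in> X"
  shows "T (iterate X T n x) = iterate X T (n + 1) x"
proof (cases "0 \<le> n")
  case True
  then show ?thesis by (simp add: iterate_def nat_add_distrib)
next
  case False
  define k where "k = nat (- n - 1)"
  have n: "n = - int (Suc k)" using False by (simp add: k_def)
  have e: "iterate X T (- int k) x = (inv_into X T ^^ k) x"
    by (cases k) (auto simp: iterate_def nat_add_distrib)
  then have "(inv_into X T ^^ k) x \<in> T ` X"
    using iterate_in[OF assms, of "- int k"] system_image[OF assms(1)] by simp
  then have "T (inv_into X T ((inv_into X T ^^ k) x)) = (inv_into X T ^^ k) x"
    by (rule f_inv_into_f)
  moreover have "iterate X T n x = inv_into X T ((inv_into X T ^^ k) x)"
    unfolding n iterate_def by (simp add: nat_add_distrib)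
  moreover have "n + 1 = - int k" using n by simp
  ultimately show ?thesis using e by simp
qed

lemma system_orbit_closure:
  assumes "system X T" "x \<in> X"
  shows "system (orbit_closure X T x) T" "orbit_closure X T x \<subseteq> X"
proof -
  let ?O = "orbit X T x" and ?C = "orbit_closure X T x"
  from assms(1) obtain T' where X: "compact X" and h: "homeomorphism X X T T'"
    by (auto simp: system_def)
  have OX: "?O \<subseteq> X" using iterate_in[OF assms] by (auto simp: orbit_def)
  then show CX: "?C \<subseteq> X"
    using X by (simp add: orbit_closure_def closure_minimal compact_imp_closed)
  have C: "compact ?C"
    using compact_Int_closed[OF X, of ?C] CX
    by (simp add: orbit_closure_def Int_absorb1)
  have "T ` ?O = (\<lambda>n. iterate X T (n + 1) x) ` UNIV"
    using iterate_Suc[OF assms] by (auto simp: orbit_def image_image)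
  also have "\<dots> = (\<lambda>n. iterate X T n x) ` ((\<lambda>n. n + 1) ` UNIV)"
    by (simp only: image_image)
  also have "(\<lambda>n::int. n + 1) ` UNIV = UNIV"
    by (rule surjI[where f = "\<lambda>n. n - 1"]) simp
  finally have O: "T ` ?O = ?O" by (simp add: orbit_def)
  have cT: "continuous_on ?C T"
    using h CX continuous_on_subset by (auto simp: homeomorphism_def)
  have "T ` ?C \<subseteq> ?C"
    unfolding orbit_closure_def
    by (rule image_closure_subset)
      (use cT O closure_subset[of ?O] in \<open>simp_all add: orbit_closure_def\<close>)
  moreover have "?C \<subseteq> T ` ?C"
  proof -
    have "closed (T ` ?C)" by (simp add: C cT compact_continuous_image compact_imp_closed)
    moreover have "?O \<subseteq> T ` ?C" using O image_mono[OF closure_subset[of ?O], of T]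
      by (simp add: orbit_closure_def)
    ultimately show ?thesis by (simp add: orbit_closure_def closure_minimal)
  qed
  ultimately have "T ` ?C = ?C" by blast
  then have "homeomorphism ?C ?C T T'"
    using homeomorphism_of_subsets[OF h CX CX] by simp
  then show "system ?C T" using C by (auto simp: system_def)
qed

end

theory Submission
  imports Defs
begin

text \<open>
  A point \<open>x\<close> fails to be disjoint from \<open>Y\<close> exactly when some closed invariant \<open>J \<subseteq> X \<times> Y\<close> lies
  over \<open>x\<close> without containing the whole fibre \<open>{x} \<times> Y\<close>; minimality of \<open>Y\<close> makes the projection
  of \<open>J\<close> to \<open>Y\<close> automatic.

  If a dense set of points is disjoint from \<open>Y\<close>, each of these points has its full fibre in every
  joining \<open>J\<close> of \<open>X\<close> and \<open>Y\<close>, so \<open>J\<close> is dense and hence everything.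

  Conversely, let \<open>X\<close> be disjoint from \<open>Y\<close>. For open \<open>V \<subseteq> X\<close> and nonempty open \<open>W \<subseteq> Y\<close> let
  \<open>K\<close> be the largest closed invariant subset of \<open>X \<times> Y\<close> missing \<open>V \<times> W\<close>, and \<open>P\<close> its projection
  to \<open>X\<close>. A point that is not disjoint from \<open>Y\<close> lies in \<open>V \<inter> P\<close> for some basic \<open>V\<close> and \<open>W\<close>, so by
  Baire's theorem it suffices that each \<open>V \<inter> P\<close> is nowhere dense. The point is that if \<open>V \<noteq> {}\<close>
  were contained in \<open>P\<close> then \<open>K\<close> would be a joining: an orbit closure that meets \<open>V\<close> has its base
  point in \<open>P\<close> by invariance of \<open>P\<close>, while an orbit closure \<open>C\<close> that avoids \<open>V\<close> contributes all of
  \<open>C \<times> Y\<close> to \<open>K\<close>. So \<open>P = X\<close>, although \<open>K\<close> misses \<open>V \<times> W\<close>, contradicting disjointness. Shrinking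
  \<open>V\<close> only enlarges \<open>K\<close>, so \<open>P\<close> contains no nonempty open part of \<open>V\<close> either.
\<close>

section \<open>Invariant sets\<close>

lemma system_facts:
  assumes "system X T"
  shows "compact X" "closed X" "continuous_on X T" "inj_on T X" "T ` X = X"
proof -
  from assms obtain T' where X: "compact X" and h: "homeomorphism X X T T'"
    by (auto simp: system_def)
  from X show "compact X" "closed X" by (auto intro: compact_imp_closed)
  from h show "continuous_on X T" "T ` X = X" by (auto simp: homeomorphism_def)
  from h have "T' (T x) = x" if "x \<in> X" for x using that by (simp add: homeomorphism_def)
  then show "inj_on T X" by (rule inj_on_inverseI)
qed

lemma system_Times:
  assumes "system X T" "system Y S"
  shows "system (X \<times> Y) (map_prod T S)"
proof -
  from assms obtain T' S' where "compact X" "compact Y"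
    and T: "homeomorphism X X T T'" and S: "homeomorphism Y Y S S'"
    by (auto simp: system_def)
  have cont: "continuous_on (X \<times> Y) (map_prod f g)"
    if "continuous_on X f" "continuous_on Y g" for f :: "'a \<Rightarrow> 'a" and g :: "'b \<Rightarrow> 'b"
    unfolding map_prod_def case_prod_unfold
    by (intro continuous_intros continuous_on_compose2[OF that(1)]
        continuous_on_compose2[OF that(2)]) auto
  have "homeomorphism (X \<times> Y) (X \<times> Y) (map_prod T S) (map_prod T' S')"
    using T S unfolding homeomorphism_def
    by (simp add: cont map_prod_surj_on)
  then show ?thesis
    using compact_Times[OF \<open>compact X\<close> \<open>compact Y\<close>] by (auto simp: system_def)
qed

lemma invariant_iff:
  assumes "system X T" "A \<subseteq> X" "T ` A = A" "x \<in> X"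
  shows "T x \<in> A \<longleftrightarrow> x \<in> A"
proof
  assume "T x \<in> A"
  then obtain a where "a \<in> A" "T x = T a" using assms(3) by (metis imageE)
  then show "x \<in> A"
    using inj_onD[OF system_facts(4)[OF assms(1)], of x a] assms(2,4) by auto
next
  assume "x \<in> A"
  then show "T x \<in> A" using assms(3) by blast
qed

lemma iterate_invariant_iff:
  assumes sys: "system X T" and A: "A \<subseteq> X" "T ` A = A" and x: "x \<in> X"
  shows "iterate X T n x \<in> A \<longleftrightarrow> x \<in> A"
proof -
  have step: "iterate X T (n + 1) x \<in> A \<longleftrightarrow> iterate X T n x \<in> A" for n
    using invariant_iff[OF sys A iterate_in[OF sys x]] iterate_Suc[OF sys x] by simp
  show ?thesis
  proof (induction n rule: int_induct[where k = 0])
    case base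
    then show ?case by (simp add: iterate_def)
  next
    case (step1 i)
    then show ?case using step by simp
  next
    case (step2 i)
    then show ?case using step[of "i - 1"] by simp
  qed
qed

lemma in_orbit_closure: "x \<in> orbit_closure X T x"
proof -
  have "iterate X T 0 x = x" by (simp add: iterate_def)
  then have "x \<in> orbit X T x" unfolding orbit_def by (metis rangeI)
  then show ?thesis unfolding orbit_closure_def using closure_subset by blast
qed

lemma invariant_closure:
  assumes sys: "system X T" and A: "A \<subseteq> X" "T ` A = A"
  shows "closure A \<subseteq> X" "T ` closure A = closure A"
proof -
  show C: "closure A \<subseteq> X" using A system_facts(2)[OF sys] by (simp add: closure_minimal)
  have cT: "continuous_on (closure A) T"
    using C system_facts(3)[OF sys] continuous_on_subset by blast
  have "compact (closure A)"
    using compact_Int_closed[OF system_facts(1)[OF sys] closed_closure, of A] C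
    by (simp add: Int_absorb1)
  then have "closed (T ` closure A)"
    by (simp add: cT compact_continuous_image compact_imp_closed)
  moreover have "A \<subseteq> T ` closure A" using A(2) closure_subset[of A] by blast
  ultimately have "closure A \<subseteq> T ` closure A" by (simp add: closure_minimal)
  moreover have "T ` closure A \<subseteq> closure A"
    by (rule image_closure_subset) (use cT A(2) closure_subset[of A] in auto)
  ultimately show "T ` closure A = closure A" by blast
qed

lemma minimal_system_closed_invariant:
  assumes "minimal_system Y S" "A \<subseteq> Y" "A \<noteq> {}" "closed A" "S ` A = A"
  shows "A = Y"
  using assms closed_subset[of A Y] unfolding minimal_system_def by blast

lemma closed_invariant_projections:
  assumes sys: "system X T" "system Y S"
    and J: "J \<subseteq> X \<times> Y" "closed J" "map_prod T S ` J = J"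
  shows "closed (fst ` J)" "T ` fst ` J = fst ` J" "closed (snd ` J)" "S ` snd ` J = snd ` J"
proof -
  have "compact J"
    using compact_Int_closed[OF system_facts(1)[OF system_Times[OF sys]] J(2)] J(1)
    by (simp add: Int_absorb1)
  then show "closed (fst ` J)" "closed (snd ` J)"
    by (auto intro!: compact_imp_closed compact_continuous_image continuous_intros)
  have "fst ` map_prod T S ` J = T ` fst ` J" "snd ` map_prod T S ` J = S ` snd ` J"
    by (simp_all add: image_image)
  then show "T ` fst ` J = fst ` J" "S ` snd ` J = snd ` J"
    using J(3) by simp_all
qed

lemma snd_closed_invariant_eq_minimal:
  assumes sys: "system X T" and min: "minimal_system Y S"
    and J: "J \<subseteq> X \<times> Y" "closed J" "map_prod T S ` J = J" "J \<noteq> {}"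
  shows "snd ` J = Y"
proof (rule minimal_system_closed_invariant[OF min])
  have "system Y S" using min by (simp add: minimal_system_def)
  note P = closed_invariant_projections[OF sys this J(1-3)]
  show "closed (snd ` J)" "S ` snd ` J = snd ` J" by (fact P)+
  show "snd ` J \<subseteq> Y" "snd ` J \<noteq> {}" using J(1,4) by auto
qed

lemma joining_iff_closed:
  assumes "system X T" "system Y S"
  shows "joining X T Y S J \<longleftrightarrow>
    J \<subseteq> X \<times> Y \<and> closed J \<and> map_prod T S ` J = J \<and> fst ` J = X \<and> snd ` J = Y"
proof -
  have "closed (X \<times> Y)" using assms by (simp add: closed_Times system_facts(2))
  then show ?thesis
    unfolding joining_def by (auto simp: closedin_closed_eq closedin_subset)
qed

text \<open>
  The points with full fibre in \<open>J\<close> form an invariant set, which therefore contains the orbit of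
  each of its points; passing to the closure of the orbit preserves \<open>J\<close>.
\<close>

lemma full_fibre_orbit_closure:
  assumes sys: "system X T" "system Y S"
    and J: "J \<subseteq> X \<times> Y" "closed J" "map_prod T S ` J = J"
    and x: "x \<in> X" "{x} \<times> Y \<subseteq> J"
  shows "orbit_closure X T x \<times> Y \<subseteq> J"
proof -
  define A where "A = {x \<in> X. \<forall>y\<in>Y. (x, y) \<in> J}"
  note TX = system_facts(5)[OF sys(1)] and SY = system_facts(5)[OF sys(2)]
  have iff: "(T x, S y) \<in> J \<longleftrightarrow> (x, y) \<in> J" if "x \<in> X" "y \<in> Y" for x y
    using invariant_iff[OF system_Times[OF sys] J(1,3), of "(x, y)"] that by simp
  have iffA: "T x \<in> A \<longleftrightarrow> x \<in> A" if "x \<in> X" for x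
  proof -
    have "(\<forall>y\<in>Y. (T x, y) \<in> J) \<longleftrightarrow> (\<forall>y\<in>S ` Y. (T x, y) \<in> J)" using SY by simp
    also have "\<dots> \<longleftrightarrow> (\<forall>y\<in>Y. (x, y) \<in> J)" using iff[OF that] by simp
    finally show ?thesis using that TX by (auto simp: A_def)
  qed
  have "T ` A = A"
  proof
    show "T ` A \<subseteq> A" using iffA by (auto simp: A_def)
    show "A \<subseteq> T ` A"
    proof
      fix z assume "z \<in> A"
      then obtain w where "w \<in> X" "z = T w" using TX by (auto simp: A_def)
      then show "z \<in> T ` A" using iffA \<open>z \<in> A\<close> by blast
    qed
  qed
  moreover have "A \<subseteq> X" "x \<in> A" using x by (auto simp: A_def)
  ultimately have "orbit X T x \<subseteq> A"
    using iterate_invariant_iff[OF sys(1), of A x] x(1) by (auto simp: orbit_def)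
  then have "orbit X T x \<times> Y \<subseteq> J" by (auto simp: A_def)
  then have "closure (orbit X T x \<times> Y) \<subseteq> J" using J(2) by (simp add: closure_minimal)
  then show ?thesis
    using system_facts(2)[OF sys(2)] by (simp add: closure_Times orbit_closure_def)
qed

section \<open>The largest closed invariant set missing an open set\<close>

definition avoiding_part :: "'a::metric_space set \<Rightarrow> ('a \<Rightarrow> 'a) \<Rightarrow> 'a set \<Rightarrow> 'a set" where
  "avoiding_part Z R U = \<Union>{A. A \<subseteq> Z \<and> closed A \<and> R ` A = A \<and> A \<inter> U = {}}"

lemma avoiding_part_greatest:
  "A \<subseteq> Z \<Longrightarrow> closed A \<Longrightarrow> R ` A = A \<Longrightarrow> A \<inter> U = {} \<Longrightarrow> A \<subseteq> avoiding_part Z R U"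
  by (auto simp: avoiding_part_def)

lemma avoiding_part_antimono: "U \<subseteq> U' \<Longrightarrow> avoiding_part Z R U' \<subseteq> avoiding_part Z R U"
  unfolding avoiding_part_def by (rule Union_mono) auto

text \<open>
  The union need not be closed a priori, but its closure is again one of the sets in the union
  because \<open>U\<close> is open.
\<close>

lemma avoiding_part:
  assumes sys: "system Z R" and U: "openin (top_of_set Z) U"
  shows "avoiding_part Z R U \<subseteq> Z" "closed (avoiding_part Z R U)"
    "R ` avoiding_part Z R U = avoiding_part Z R U" "avoiding_part Z R U \<inter> U = {}"
proof -
  let ?K = "avoiding_part Z R U"
  show K: "?K \<subseteq> Z" and KU: "?K \<inter> U = {}" by (auto simp: avoiding_part_def)
  show inv: "R ` ?K = ?K" unfolding avoiding_part_def image_Union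
    by (rule arg_cong[where f = Union]) (auto simp: image_iff)
  obtain O' where O': "open O'" "U = Z \<inter> O'" using U by (auto simp: openin_open)
  then have "closure ?K \<inter> O' = {}"
    using K KU open_Int_closure_eq_empty[of O' ?K] by auto
  then have "closure ?K \<subseteq> ?K"
    using invariant_closure[OF sys K inv] O'(2) by (intro avoiding_part_greatest) auto
  then show "closed ?K" using closure_subset_eq by blast
qed

text \<open>
  An orbit closure either meets \<open>V\<close>, and then invariance puts its base point into the projection,
  or avoids \<open>V\<close>, and then its product with \<open>Y\<close> is a closed invariant set missing \<open>V \<times> W\<close>.
\<close>

lemma fst_avoiding_part_eq_space:
  assumes sys: "system X T" "system Y S" and Y: "Y \<noteq> {}"
    and V: "openin (top_of_set X) V" and W: "openin (top_of_set Y) W"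
    and sub: "V \<subseteq> fst ` avoiding_part (X \<times> Y) (map_prod T S) (V \<times> W)"
  shows "fst ` avoiding_part (X \<times> Y) (map_prod T S) (V \<times> W) = X"
proof
  let ?K = "avoiding_part (X \<times> Y) (map_prod T S) (V \<times> W)"
  have VW: "openin (top_of_set (X \<times> Y)) (V \<times> W)" using V W by (rule openin_Times)
  note K = avoiding_part[OF system_Times[OF sys] VW]
  show PX: "fst ` ?K \<subseteq> X" using K(1) by auto
  note P = closed_invariant_projections[OF sys K(1-3)]
  show "X \<subseteq> fst ` ?K"
  proof
    fix x assume x: "x \<in> X"
    let ?C = "orbit_closure X T x"
    note C = system_orbit_closure[OF sys(1) x]
    show "x \<in> fst ` ?K"
    proof (cases "?C \<inter> V = {}")
      case True
      have CY: "system (?C \<times> Y) (map_prod T S)" by (rule system_Times[OF C(1) sys(2)])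
      have "?C \<times> Y \<subseteq> ?K"
        using True C(2) system_facts(2,5)[OF CY] by (intro avoiding_part_greatest) auto
      then show ?thesis using in_orbit_closure[of x X T] Y by force
    next
      case False
      obtain O' where O': "open O'" "V = X \<inter> O'" using V by (auto simp: openin_open)
      with False have "O' \<inter> closure (orbit X T x) \<noteq> {}" by (auto simp: orbit_closure_def)
      then have "O' \<inter> orbit X T x \<noteq> {}" using open_Int_closure_eq_empty[OF O'(1)] by blast
      then obtain n where "iterate X T n x \<in> V"
        using O'(2) iterate_in[OF sys(1) x] by (auto simp: orbit_def)
      then have "iterate X T n x \<in> fst ` ?K" using sub by blast
      then show ?thesis using iterate_invariant_iff[OF sys(1) PX P(2) x] by blast
    qed
  qed
qed

lemma disjoint_imp_not_subset_fst_avoiding_part: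
  assumes sys: "system X T" and min: "minimal_system Y S" and disj: "disjoint_systems X T Y S"
    and V: "openin (top_of_set X) V" "V \<noteq> {}" and W: "openin (top_of_set Y) W" "W \<noteq> {}"
  shows "\<not> V \<subseteq> fst ` avoiding_part (X \<times> Y) (map_prod T S) (V \<times> W)"
proof
  let ?K = "avoiding_part (X \<times> Y) (map_prod T S) (V \<times> W)"
  assume sub: "V \<subseteq> fst ` ?K"
  have sysY: "system Y S" using min by (simp add: minimal_system_def)
  have VX: "V \<subseteq> X" and WY: "W \<subseteq> Y"
    by (rule openin_imp_subset[OF V(1)], rule openin_imp_subset[OF W(1)])
  have VW: "openin (top_of_set (X \<times> Y)) (V \<times> W)" using V(1) W(1) by (rule openin_Times)
  note K = avoiding_part[OF system_Times[OF sys sysY] VW]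
  have "Y \<noteq> {}" using WY W(2) by blast
  then have fst: "fst ` ?K = X"
    by (rule fst_avoiding_part_eq_space[OF sys sysY _ V(1) W(1) sub])
  have "?K \<noteq> {}" using sub V(2) by auto
  then have "snd ` ?K = Y" by (rule snd_closed_invariant_eq_minimal[OF sys min K(1-3)])
  with fst K(1-3) have "joining X T Y S ?K"
    unfolding joining_iff_closed[OF sys sysY] by (intro conjI)
  then have "?K = X \<times> Y" using disj unfolding disjoint_systems_def by blast
  with K(4) have "(X \<times> Y) \<inter> (V \<times> W) = {}" by (simp only:)
  moreover have "V \<times> W \<subseteq> X \<times> Y" using VX WY by (rule Sigma_mono)
  ultimately have "V \<times> W = {}" by (simp only: Int_absorb1)
  then show False using V(2) W(2) by simp
qed

text \<open>
  Any nonempty open set inside the closure of \<open>V \<inter> P\<close>, with \<open>P\<close> the projection, would meet \<open>V\<close> in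
  a nonempty open set \<open>V' \<subseteq> P\<close>, and replacing \<open>V\<close> by \<open>V'\<close> enlarges \<open>P\<close>.
\<close>

lemma disjoint_imp_nowhere_dense:
  assumes sys: "system X T" and min: "minimal_system Y S" and disj: "disjoint_systems X T Y S"
    and V: "openin (top_of_set X) V" and W: "openin (top_of_set Y) W" "W \<noteq> {}"
  shows "top_of_set X interior_of (top_of_set X closure_of
    (V \<inter> fst ` avoiding_part (X \<times> Y) (map_prod T S) (V \<times> W))) = {}"
    (is "?X interior_of (?X closure_of (V \<inter> ?P)) = {}")
proof (rule ccontr)
  let ?O = "?X interior_of (?X closure_of (V \<inter> ?P))"
  assume "?O \<noteq> {}"
  then obtain x where x: "x \<in> ?O" by blast
  have O: "openin ?X ?O" "?O \<subseteq> ?X closure_of (V \<inter> ?P)"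
    by (rule openin_interior_of, rule interior_of_subset)
  define V' where "V' = ?O \<inter> V"
  have V': "openin ?X V'" unfolding V'_def using O(1) V by (rule openin_Int)
  have "x \<in> ?X closure_of (V \<inter> ?P)" using x O(2) by blast
  then obtain z where "z \<in> V \<inter> ?P" "z \<in> ?O"
    unfolding in_closure_of using x O(1) by meson
  then have "V' \<noteq> {}" by (auto simp: V'_def)
  have sysY: "system Y S" using min by (simp add: minimal_system_def)
  have VW: "openin (top_of_set (X \<times> Y)) (V \<times> W)" using V W(1) by (rule openin_Times)
  note K = avoiding_part[OF system_Times[OF sys sysY] VW]
  have "?P \<subseteq> X" using K(1) by auto
  then have "closedin ?X ?P"
    using closed_invariant_projections(1)[OF sys sysY K(1-3)] by (simp add: closed_subset)
  then have "?X closure_of (V \<inter> ?P) \<subseteq> ?P" by (simp add: closure_of_minimal)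
  then have "V' \<subseteq> ?P" using O(2) by (auto simp: V'_def)
  also have "?P \<subseteq> fst ` avoiding_part (X \<times> Y) (map_prod T S) (V' \<times> W)"
    by (intro image_mono avoiding_part_antimono) (auto simp: V'_def)
  finally show False
    using disjoint_imp_not_subset_fst_avoiding_part[OF sys min disj V' \<open>V' \<noteq> {}\<close> W] by blast
qed

section \<open>Points whose orbit closure is not disjoint from \<open>Y\<close>\<close>

text \<open>
  A joining that is not the whole product misses some point \<open>(x, y)\<close> of the fibre over the base
  point \<open>x\<close>, and then, being closed, a product of basic neighbourhoods of \<open>x\<close> and \<open>y\<close>.
\<close>

lemma not_disjoint_orbit_closure_imp_in_fst_avoiding_part:
  assumes sys: "system X T" "system Y S" and x: "x \<in> X"
    and not_disj: "\<not> disjoint_systems (orbit_closure X T x) T Y S"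
    and \<B>: "\<And>U x. openin (top_of_set X) U \<Longrightarrow> x \<in> U \<Longrightarrow> \<exists>V\<in>\<B>. x \<in> V \<and> V \<subseteq> U"
    and \<C>: "\<And>U y. openin (top_of_set Y) U \<Longrightarrow> y \<in> U \<Longrightarrow> \<exists>W\<in>\<C>. y \<in> W \<and> W \<subseteq> U"
  obtains V W where "V \<in> \<B>" "W \<in> \<C>" "W \<noteq> {}"
    "x \<in> V \<inter> fst ` avoiding_part (X \<times> Y) (map_prod T S) (V \<times> W)"
proof -
  let ?C = "orbit_closure X T x"
  note C = system_orbit_closure[OF sys(1) x]
  obtain J where join: "joining ?C T Y S J" and "J \<noteq> ?C \<times> Y"
    using not_disj unfolding disjoint_systems_def by blast
  then have J: "J \<subseteq> ?C \<times> Y" "closed J" "map_prod T S ` J = J" "fst ` J = ?C"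
    unfolding joining_iff_closed[OF C(1) sys(2)] by blast+
  have JZ: "J \<subseteq> X \<times> Y" using J(1) C(2) by blast
  have "\<not> {x} \<times> Y \<subseteq> J"
    using full_fibre_orbit_closure[OF sys JZ J(2,3) x] J(1) \<open>J \<noteq> ?C \<times> Y\<close> by blast
  then obtain y where y: "y \<in> Y" "(x, y) \<notin> J" by auto
  have "open (- J)" using J(2) by (rule open_Compl)
  then obtain G H where GH: "open G" "open H" "x \<in> G" "y \<in> H" "G \<times> H \<subseteq> - J"
    using y(2) by (metis ComplI open_prod_elim mem_Sigma_iff)
  obtain V where V: "V \<in> \<B>" "x \<in> V" "V \<subseteq> X \<inter> G"
    using \<B>[OF openin_open_Int[OF GH(1)], of x] GH(3) x by blast
  obtain W where W: "W \<in> \<C>" "y \<in> W" "W \<subseteq> Y \<inter> H"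
    using \<C>[OF openin_open_Int[OF GH(2)], of y] GH(4) y(1) by blast
  have "J \<inter> V \<times> W = {}" using V(3) W(3) GH(5) by blast
  then have "J \<subseteq> avoiding_part (X \<times> Y) (map_prod T S) (V \<times> W)"
    by (rule avoiding_part_greatest[OF JZ J(2,3)])
  moreover have "x \<in> fst ` J" using J(4) in_orbit_closure by simp
  ultimately show thesis using that V W by blast
qed

lemma compact_imp_second_countable:
  fixes X :: "'a::metric_space set"
  assumes "compact X"
  shows "second_countable (top_of_set X)"
proof -
  define r :: "nat \<Rightarrow> real" where "r n = inverse (Suc n)" for n
  have "\<exists>k. finite k \<and> X \<subseteq> (\<Union>c\<in>k. ball c (r n))" for n
    using assms unfolding compact_eq_totally_bounded by (simp add: r_def)
  then have "\<forall>n. \<exists>k. finite k \<and> X \<subseteq> (\<Union>c\<in>k. ball c (r n))" by blast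
  from choice[OF this] obtain k
    where k: "\<And>n. finite (k n)" "\<And>n. X \<subseteq> (\<Union>c\<in>k n. ball c (r n))"
    by blast
  define \<B> where "\<B> = (\<Union>n. (\<lambda>c. X \<inter> ball c (r n)) ` k n)"
  have "countable \<B>" unfolding \<B>_def using k(1) by (auto intro: countable_finite)
  moreover have "\<forall>V\<in>\<B>. openin (top_of_set X) V" unfolding \<B>_def by (auto simp: openin_open_Int)
  moreover have "\<exists>V\<in>\<B>. x \<in> V \<and> V \<subseteq> U" if U: "openin (top_of_set X) U" and x: "x \<in> U" for U x
  proof -
    have "\<exists>e>0. ball x e \<inter> X \<subseteq> U" and "x \<in> X"
      using U x unfolding openin_contains_ball by auto
    then obtain e where e: "e > 0" "ball x e \<inter> X \<subseteq> U" "x \<in> X" by blast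
    then obtain n where n: "r n < e / 2"
      using reals_Archimedean[of "e / 2"] unfolding r_def by auto
    obtain c where c: "c \<in> k n" "x \<in> ball c (r n)" using k(2) e(3) by blast
    have "ball c (r n) \<subseteq> ball x e"
    proof
      fix z assume "z \<in> ball c (r n)"
      then show "z \<in> ball x e"
        using c(2) n dist_triangle[of x z c] by (simp add: dist_commute)
    qed
    then have "X \<inter> ball c (r n) \<subseteq> U" using e(2) by blast
    moreover have "X \<inter> ball c (r n) \<in> \<B>" unfolding \<B>_def using c(1) by blast
    moreover have "x \<in> X \<inter> ball c (r n)" using c(2) e(3) by (rule IntI[rotated])
    ultimately show ?thesis by blast
  qed
  ultimately show ?thesis unfolding second_countable_def by blast
qed

text \<open>
  Countable bases of \<open>X\<close> and \<open>Y\<close> leave only countably many nowhere dense sets to remove.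
\<close>

lemma disjoint_imp_residual:
  assumes sys: "system X T" and min: "minimal_system Y S" and disj: "disjoint_systems X T Y S"
  shows "residual_in (top_of_set X) {x \<in> X. disjoint_systems (orbit_closure X T x) T Y S}"
proof -
  let ?X = "top_of_set X"
  have sysY: "system Y S" using min by (simp add: minimal_system_def)
  have cX: "compact X" and cY: "compact Y" using system_facts(1) sys sysY by blast+
  obtain \<B> where "countable \<B> \<and> (\<forall>V\<in>\<B>. openin ?X V) \<and>
    (\<forall>U x. openin ?X U \<and> x \<in> U \<longrightarrow> (\<exists>V\<in>\<B>. x \<in> V \<and> V \<subseteq> U))"
    using compact_imp_second_countable[OF cX, unfolded second_countable_def] by (rule exE)
  then have \<B>: "countable \<B>" "\<And>V. V \<in> \<B> \<Longrightarrow> openin ?X V"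
    "\<And>U x. openin ?X U \<Longrightarrow> x \<in> U \<Longrightarrow> \<exists>V\<in>\<B>. x \<in> V \<and> V \<subseteq> U"
    by simp_all
  obtain \<C> where "countable \<C> \<and> (\<forall>W\<in>\<C>. openin (top_of_set Y) W) \<and>
    (\<forall>U y. openin (top_of_set Y) U \<and> y \<in> U \<longrightarrow> (\<exists>W\<in>\<C>. y \<in> W \<and> W \<subseteq> U))"
    using compact_imp_second_countable[OF cY, unfolded second_countable_def] by (rule exE)
  then have \<C>: "countable \<C>" "\<And>W. W \<in> \<C> \<Longrightarrow> openin (top_of_set Y) W"
    "\<And>U y. openin (top_of_set Y) U \<Longrightarrow> y \<in> U \<Longrightarrow> \<exists>W\<in>\<C>. y \<in> W \<and> W \<subseteq> U"
    by simp_all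
  define N where "N V W = V \<inter> fst ` avoiding_part (X \<times> Y) (map_prod T S) (V \<times> W)" for V W
  \<comment> \<open>Inserting \<open>X\<close> keeps the family nonempty also when \<open>Y\<close> is empty.\<close>
  define \<G> where "\<G> = insert X ((\<lambda>(V, W). X - ?X closure_of N V W) ` (\<B> \<times> (\<C> - {{}})))"
  have cnt: "countable \<G>"
    unfolding \<G>_def using \<B>(1) \<C>(1)
    by (intro countable_insert countable_image countable_SIGMA countable_Diff)
  have G: "openin ?X G \<and> ?X closure_of G = topspace ?X" if "G \<in> \<G>" for G
  proof (cases "G = X")
    case True
    then show ?thesis using openin_topspace[of ?X] closure_of_topspace[of ?X] by simp
  next
    case False
    then have "G \<in> (\<lambda>(V, W). X - ?X closure_of N V W) ` (\<B> \<times> (\<C> - {{}}))"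
      using that unfolding \<G>_def by blast
    then obtain p where p: "p \<in> \<B> \<times> (\<C> - {{}})" "G = (\<lambda>(V, W). X - ?X closure_of N V W) p"
      by blast
    obtain V W where "p = (V, W)" by (cases p)
    with p have VW: "V \<in> \<B>" "W \<in> \<C>" "W \<noteq> {}" "G = X - ?X closure_of N V W" by simp_all
    define F where "F = ?X closure_of N V W"
    have "openin ?X (topspace ?X - F)"
      unfolding F_def by (rule openin_diff[OF openin_topspace closedin_closure_of])
    moreover have "?X interior_of F = {}"
      unfolding F_def N_def
      by (rule disjoint_imp_nowhere_dense[OF sys min disj \<B>(2)[OF VW(1)] \<C>(2)[OF VW(2)] VW(3)])
    then have "?X closure_of (topspace ?X - F) = topspace ?X"
      by (simp only: closure_of_complement Diff_empty)
    moreover have "G = topspace ?X - F" unfolding VW(4) F_def by simp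
    ultimately show ?thesis by (simp only:)
  qed
  have "gdelta_in ?X (\<Inter>\<G>)"
  proof (rule gdelta_in_Inter[OF cnt])
    show "\<G> \<noteq> {}" by (simp add: \<G>_def)
    show "gdelta_in ?X G" if "G \<in> \<G>" for G
      using G[OF that] by (intro open_imp_gdelta_in) (rule conjunct1)
  qed
  moreover have "?X closure_of \<Inter>\<G> = topspace ?X"
  proof (rule Baire_category[OF disjI2 cnt G])
    have "compact_space ?X" using cX by (simp add: compact_space_subtopology)
    then show "locally_compact_space ?X \<and> regular_space ?X"
      by (simp add: compact_imp_locally_compact_space regular_space_euclidean
          regular_space_subtopology)
  qed
  moreover have "\<Inter>\<G> \<subseteq> {x \<in> X. disjoint_systems (orbit_closure X T x) T Y S}"
  proof
    fix x assume x: "x \<in> \<Inter>\<G>"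
    then have "x \<in> X" by (simp add: \<G>_def)
    moreover have "disjoint_systems (orbit_closure X T x) T Y S"
    proof (rule ccontr)
      assume "\<not> ?thesis"
      then obtain V W where VW: "V \<in> \<B>" "W \<in> \<C>" "W \<noteq> {}" "x \<in> N V W"
        unfolding N_def
        by (rule not_disjoint_orbit_closure_imp_in_fst_avoiding_part
            [OF sys sysY \<open>x \<in> X\<close> _ \<B>(3) \<C>(3)]) auto
      have "N V W \<subseteq> topspace ?X" using \<B>(2)[OF VW(1)] openin_imp_subset by (auto simp: N_def)
      then have "x \<in> ?X closure_of N V W" using VW(4) closure_of_subset by blast
      moreover have "X - ?X closure_of N V W \<in> \<G>" using VW by (auto simp: \<G>_def)
      ultimately show False using x by blast
    qed
    ultimately show "x \<in> {x \<in> X. disjoint_systems (orbit_closure X T x) T Y S}" by blast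
  qed
  ultimately show ?thesis unfolding residual_in_def by auto
qed

section \<open>Disjointness from a dense set of disjoint orbit closures\<close>

text \<open>
  The part of \<open>J\<close> over an orbit closure is a joining of that orbit closure with \<open>Y\<close>: it projects
  onto \<open>Y\<close> by minimality.
\<close>

lemma joining_full_fibre:
  assumes sys: "system X T" and min: "minimal_system Y S" and J: "joining X T Y S J"
    and x: "x \<in> X" and disj: "disjoint_systems (orbit_closure X T x) T Y S"
  shows "{x} \<times> Y \<subseteq> J"
proof -
  let ?C = "orbit_closure X T x"
  have sysY: "system Y S" using min by (simp add: minimal_system_def)
  note C = system_orbit_closure[OF sys x]
  have J: "J \<subseteq> X \<times> Y" "closed J" "map_prod T S ` J = J" "fst ` J = X"
    using J joining_iff_closed[OF sys sysY] by auto
  define L where "L = J \<inter> ?C \<times> Y"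
  note CY = system_facts[OF system_Times[OF C(1) sysY]]
  have L: "L \<subseteq> ?C \<times> Y" "closed L" using J(2) CY(2) by (auto simp: L_def)
  have CZ: "?C \<times> Y \<subseteq> X \<times> Y" using C(2) by auto
  have L3: "map_prod T S ` L = L" unfolding L_def
    using inj_on_image_Int[OF system_facts(4)[OF system_Times[OF sys sysY]] J(1) CZ] J(3) CY(5)
    by simp
  have fst: "fst ` L = ?C" using J(1,4) C(2) by (force simp: L_def)
  then have "L \<noteq> {}" using in_orbit_closure[of x X T] by auto
  then have "snd ` L = Y" by (rule snd_closed_invariant_eq_minimal[OF C(1) min L L3])
  with L L3 fst have "joining ?C T Y S L"
    unfolding joining_iff_closed[OF C(1) sysY] by (intro conjI)
  then have "L = ?C \<times> Y" using disj unfolding disjoint_systems_def by blast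
  then show ?thesis using in_orbit_closure[of x X T] by (auto simp: L_def)
qed

lemma residual_imp_disjoint:
  assumes sys: "system X T" and min: "minimal_system Y S"
    and res: "residual_in (top_of_set X) {x \<in> X. disjoint_systems (orbit_closure X T x) T Y S}"
  shows "disjoint_systems X T Y S"
  unfolding disjoint_systems_def
proof (intro allI impI)
  fix J assume J: "joining X T Y S J"
  have sysY: "system Y S" using min by (simp add: minimal_system_def)
  have JZ: "J \<subseteq> X \<times> Y" "closed J" using J joining_iff_closed[OF sys sysY] by auto
  obtain G where G: "top_of_set X closure_of G = X"
    "G \<subseteq> {x \<in> X. disjoint_systems (orbit_closure X T x) T Y S}"
    using res by (auto simp: residual_in_def)
  have "G \<subseteq> X" using G(2) by blast
  then have "X \<inter> closure G = X"
    using G(1) by (simp add: closure_of_subtopology Int_absorb1)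
  then have "X \<subseteq> closure G" by blast
  moreover have "G \<times> Y \<subseteq> J" using G(2) joining_full_fibre[OF sys min J] by blast
  then have "closure (G \<times> Y) \<subseteq> J" using JZ(2) by (simp add: closure_minimal)
  ultimately have "X \<times> Y \<subseteq> J" using closure_subset[of Y] by (auto simp: closure_Times)
  then show "J = X \<times> Y" using JZ(1) by blast
qed

theorem corollary4p4:
  fixes X :: "'a::metric_space set" and T :: "'a \<Rightarrow> 'a"
    and Y :: "'b::metric_space set" and S :: "'b \<Rightarrow> 'b"
  assumes "system X T" and "minimal_system Y S"
  shows "disjoint_systems X T Y S \<longleftrightarrow>
    residual_in (top_of_set X) {x \<in> X. disjoint_systems (orbit_closure X T x) T Y S}"
  using disjoint_imp_residual[OF assms] residual_imp_disjoint[OF assms] by blast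

end
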